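(* Let $R$ be a finite Frobenius ring of order $n$ with unit group $R^*$. Let $f:R\to R$ be a map that is not the sum of an additive map and a constant. If $M\subseteq R$ is such that for every $m\in M$ the map $x\mapsto f(x)-mx$ is a permutation of $R$, and such that for all $m,m'\in M$ with $m\neq m'$ we have $m-m'\in R^*$, then there exist $|M|$ mutually orthogonal quantum Latin squares of order $n$, exactly one of which is non-classical.
   Context: Rings are with identity. An additive character of a finite ring $R$ is a group morphism $\chi:(R,+)\to(\mathbb{T},\cdot)$, where $\mathbb{T}=\{z\in\mathbb{C}:|z|=1\}$. A finite ring $R$ is a Frobenius ring if it admits a generating character, i.e. an additive character $\chi$ such that every additive character of $R$ is of the form $x\mapsto\chi(ax)$ for a unique $a\in R$. The unit group $R^*$ is the set of invertible elements of $R$. A map $g:R\to R$ is additive if $g(x+y)=g(x)+g(y)$ for all $x,y\in R$. A quantum Latin square of order $n$ is an $n\times n$ matrix with entries in $\mathbb{C}^n$ such that the entries of each row and the entries of each column form an orthonormal basis of $\mathbb{C}^n$. Two quantum Latin squares $(\psi_{ij})$ and $(\phi_{ij})$ of order $n$ are orthogonal if $\{\psi_{ij}\otimes\phi_{ij}\}_{i,j}$ is an orthonormal basis of $\mathbb{C}^n\otimes\mathbb{C}^n$. A set of $t$ mutually orthogonal quantum Latin squares of order $n$ is a set of $t$ quantum Latin squares of order $n$ any two of which are orthogonal. Two quantum Latin squares are isotopic if they can be obtained from one another by multiplying each entry by a phase factor (a complex number of modulus one, which may depend on the entry), permuting rows and columns, and applying one unitary transformation of $\mathbb{C}^n$ to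 all entries. A quantum Latin square is classical if it is isotopic to one all of whose entries lie in a fixed orthonormal basis $\{|1\rangle,\dots,|n\rangle\}$ of $\mathbb{C}^n$ (this does not depend on the chosen basis); otherwise it is non-classical.
   Formalization: The set M is assumed to be non-empty; for empty M the claim fails, since a set of 0 squares cannot contain exactly one non-classical square (e.g. R = Z/4, f(x) = x^2). *)

theory Defs
  imports "HOL-Analysis.Analysis"
begin

section \<open>Finite Frobenius rings\<close>

text \<open>
  Rings are unital and not necessarily commutative. They are rendered by the sort
  \<open>{finite, ring, monoid_mult}\<close>, which is \<open>{finite, ring_1}\<close> without the axiom \<open>0 \<noteq> 1\<close>,
  so that the zero ring is included.
\<close>

definition additive_character :: "('a::{finite,ring,monoid_mult} \<Rightarrow> complex) \<Rightarrow> bool" where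
  "additive_character \<omega> \<longleftrightarrow>
     (\<forall>x. norm (\<omega> x) = 1) \<and> (\<forall>x y. \<omega> (x + y) = \<omega> x * \<omega> y)"

definition generating_character :: "('a::{finite,ring,monoid_mult} \<Rightarrow> complex) \<Rightarrow> bool" where
  "generating_character \<omega> \<longleftrightarrow>
     additive_character \<omega> \<and>
     (\<forall>\<eta>. additive_character \<eta> \<longrightarrow> (\<exists>!a. \<eta> = (\<lambda>x. \<omega> (a * x))))"

definition frobenius_ring :: "'a::{finite,ring,monoid_mult} itself \<Rightarrow> bool" where
  "frobenius_ring _ \<longleftrightarrow> (\<exists>\<omega> :: 'a \<Rightarrow> complex. generating_character \<omega>)"

definition ring_units :: "'a::{ring,monoid_mult} set" where
  "ring_units = {u. \<exists>v. u * v = 1 \<and> v * u = 1}"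

section \<open>Hermitian geometry of \<open>\<complex>\<^sup>n\<close>\<close>

text \<open>
  The library's \<open>\<bullet>\<close> on \<open>complex^'n\<close> is the real inner product (the real part of the one below).
\<close>

definition cinner :: "complex^'n \<Rightarrow> complex^'n \<Rightarrow> complex" where
  "cinner x y = (\<Sum>k\<in>UNIV. cnj (x $ k) * y $ k)"

text \<open>Bases are indexed families, so that orthonormality includes distinctness of the members.\<close>

definition orthonormal_basis :: "('k \<Rightarrow> complex^'n) \<Rightarrow> bool" where
  "orthonormal_basis v \<longleftrightarrow>
     (\<forall>k l. cinner (v k) (v l) = (if k = l then 1 else 0)) \<and>
     vec.span (range v) = UNIV"

definition unitary :: "complex^'n^'n \<Rightarrow> bool" where
  "unitary U \<longleftrightarrow>
     (let U' = map_matrix cnj (transpose U) in U ** U' = mat 1 \<and> U' ** U = mat 1)"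

text \<open>\<open>\<complex>\<^sup>m \<otimes> \<complex>\<^sup>n\<close> is identified with \<open>\<complex>\<^bsup>m \<times> n\<^esup>\<close> in the usual way.\<close>

definition tensor :: "complex^'m \<Rightarrow> complex^'n \<Rightarrow> complex^('m \<times> 'n)" where
  "tensor x y = (\<chi> p. x $ fst p * y $ snd p)"

section \<open>Quantum Latin squares\<close>

text \<open>
  A square of order \<open>n = CARD('n)\<close> has its rows, its columns and the coordinates of its entries
  indexed by \<open>'n\<close>.
\<close>

type_synonym 'n vector_square = "'n \<Rightarrow> 'n \<Rightarrow> complex^'n"

definition quantum_latin_square :: "'n::finite vector_square \<Rightarrow> bool" where
  "quantum_latin_square \<psi> \<longleftrightarrow>
     (\<forall>i. orthonormal_basis (\<lambda>j. \<psi> i j)) \<and> (\<forall>j. orthonormal_basis (\<lambda>i. \<psi> i j))"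

definition orthogonal_qls :: "'n::finite vector_square \<Rightarrow> 'n vector_square \<Rightarrow> bool" where
  "orthogonal_qls \<psi> \<phi> \<longleftrightarrow> orthonormal_basis (\<lambda>(i, j). tensor (\<psi> i j) (\<phi> i j))"

definition mutually_orthogonal_qls :: "'n::finite vector_square set \<Rightarrow> bool" where
  "mutually_orthogonal_qls Q \<longleftrightarrow>
     (\<forall>\<psi>\<in>Q. quantum_latin_square \<psi>) \<and> pairwise orthogonal_qls Q"

definition isotopic :: "'n::finite vector_square \<Rightarrow> 'n vector_square \<Rightarrow> bool" where
  "isotopic \<psi> \<phi> \<longleftrightarrow>
     (\<exists>c \<sigma> \<tau> U. (\<forall>i j. norm (c i j) = 1) \<and> bij \<sigma> \<and> bij \<tau> \<and> unitary U \<and>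
        (\<forall>i j. \<phi> i j = c i j *s (U *v \<psi> (\<sigma> i) (\<tau> j))))"

text \<open>
  The fixed orthonormal basis is the standard one, \<open>axis k 1\<close>; the choice is immaterial because
  isotopy allows an arbitrary unitary.
\<close>

definition classical_qls :: "'n::finite vector_square \<Rightarrow> bool" where
  "classical_qls \<psi> \<longleftrightarrow>
     (\<exists>\<phi>. quantum_latin_square \<phi> \<and> isotopic \<psi> \<phi> \<and> (\<forall>i j. \<exists>k. \<phi> i j = axis k 1))"

end

theory Submission
  imports Defs
begin

text \<open>
  Write \<open>n\<close> for the order of \<open>R\<close> and let \<open>\<omega>\<close> be a generating character.  Consider the plane
  \<open>R \<times> R\<close> with the classes of parallel lines \<open>x = const\<close> and \<open>y - x m = const\<close>, \<open>m \<in> M\<close>.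
  Two of these classes, the vertical one and that of a slope \<open>m\<^sub>0 \<in> M\<close>, serve as rows and columns;
  since differences of slopes are units, each of the remaining classes gives a classical Latin
  square, and these are mutually orthogonal.  In the coordinates \<open>(x, c)\<close> with
  \<open>c = y - x m\<^sub>0\<close> the square of slope \<open>m\<close> is \<open>x a + c\<close> with \<open>a = m\<^sub>0 - m\<close>.

  The last square attaches to \<open>(x, c)\<close> the vector of \<open>\<complex>\<^sup>R\<close> with coordinates
  \<open>\<omega> (c t - x g t) / \<surd>n\<close>, where \<open>g t = f t - m\<^sub>0 t\<close>.  Along a line \<open>x a + c = l\<close> its exponent is
  \<open>l t - x (g t + a t)\<close>, and \<open>t \<mapsto> g t + a t = f t - m t\<close> is a permutation.  The inner product of
  two entries of the line is therefore a full character sum \<open>\<Sum>\<^sub>s \<omega> (d s)\<close>, with \<open>d\<close> a difference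
  of two values of \<open>x\<close>, and vanishes for \<open>d \<noteq> 0\<close>
  (lemma \<open>sum_generating_character\<close>).  In a row the terms with \<open>x\<close> cancel, and the inner product is
  such a sum with \<open>d\<close> a difference of two values of \<open>c\<close>.  So every line of every class carries an orthonormal basis,
  which says that this is a quantum Latin square orthogonal to all the classical ones.

  If this square were classical, its entries would lie on only \<open>n\<close> complex lines, so that every row
  \<open>x\<close> would contain a multiple of the constant vector standing at \<open>(0, 0)\<close>
  (lemma \<open>classical_qls_parallel_in_row\<close>).  Then \<open>t \<mapsto> \<omega> (x (g t - g 0))\<close>
  would be a character for every \<open>x\<close>, and since the
  characters \<open>z \<mapsto> \<omega> (x z)\<close> separate points, \<open>g\<close>, and with it \<open>f\<close>, would be additive up to a
  constant.
\<close>

section \<open>Generating characters\<close>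

lemma additive_character_zero:
  assumes "additive_character \<omega>"
  shows "\<omega> 0 = 1"
proof -
  have "\<omega> 0 * \<omega> 0 = \<omega> 0" "\<omega> 0 \<noteq> 0"
    using assms unfolding additive_character_def
    by (metis add_0, metis norm_zero zero_neq_one)
  then show ?thesis by simp
qed

lemma additive_character_uminus:
  assumes "additive_character \<omega>"
  shows "\<omega> (- x) = cnj (\<omega> x)"
proof -
  have "\<omega> x * \<omega> (- x) = 1"
    using assms additive_character_zero[OF assms] unfolding additive_character_def
    by (metis add.right_inverse)
  moreover have "\<omega> x * cnj (\<omega> x) = 1"
    using assms unfolding additive_character_def by (simp add: complex_norm_square[symmetric])
  ultimately show ?thesis
    by (metis mult_cancel_left mult_zero_left zero_neq_one)
qed

lemma additive_character_diff:
  assumes "additive_character \<omega>"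
  shows "\<omega> (x - y) = cnj (\<omega> y) * \<omega> x"
  using assms additive_character_uminus[OF assms, of y]
  unfolding additive_character_def by (metis diff_conv_add_uminus mult.commute)

text \<open>
  Translating the summation variable by \<open>t\<close> multiplies the sum by \<open>\<omega> (d t)\<close>.  Because \<open>\<omega>\<close> is
  generating, only \<open>d = 0\<close> gives the trivial character \<open>x \<mapsto> \<omega> (d x)\<close>, so otherwise some such
  factor differs from \<open>1\<close>.
\<close>

lemma sum_generating_character:
  fixes \<omega> :: "'a::{finite,ring,monoid_mult} \<Rightarrow> complex"
  assumes "generating_character \<omega>"
  shows "(\<Sum>x\<in>UNIV. \<omega> (d * x)) = (if d = 0 then of_nat CARD('a) else 0)"
proof (cases "d = 0")
  case True
  then show ?thesis
    using assms additive_character_zero by (auto simp: generating_character_def)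
next
  case False
  have \<omega>: "additive_character \<omega>"
    and uniq: "\<And>\<eta>. additive_character \<eta> \<Longrightarrow> \<exists>!a. \<eta> = (\<lambda>x. \<omega> (a * x))"
    using assms by (auto simp: generating_character_def)
  have "\<exists>t. \<omega> (d * t) \<noteq> 1"
  proof (rule ccontr)
    assume "\<not> ?thesis"
    then have "(\<lambda>_. 1) = (\<lambda>x. \<omega> (d * x))" by auto
    moreover have "(\<lambda>_. 1) = (\<lambda>x. \<omega> (0 * x))"
      using additive_character_zero[OF \<omega>] by simp
    moreover have "additive_character (\<lambda>_ :: 'a. 1)"
      by (simp add: additive_character_def)
    ultimately show False using uniq False by blast
  qed
  then obtain t where t: "\<omega> (d * t) \<noteq> 1" by blast
  have "(\<Sum>x\<in>UNIV. \<omega> (d * x)) = (\<Sum>x\<in>UNIV. \<omega> (d * (t + x)))"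
    by (rule sum.reindex_bij_witness[of _ "\<lambda>x. t + x" "\<lambda>x. x - t"]) auto
  also have "\<dots> = \<omega> (d * t) * (\<Sum>x\<in>UNIV. \<omega> (d * x))"
    using \<omega> by (simp add: additive_character_def distrib_left sum_distrib_left)
  finally show ?thesis using t False by simp
qed

text \<open>
  By the lemma above, \<open>1 / n\<close> times the conjugate transpose of the character table
  \<open>(\<omega> (a x))\<close> is a one-sided inverse of the table.  A one-sided inverse of a square matrix is two-sided, which turns
  orthogonality of the characters into orthogonality of the columns of the table.
\<close>

lemma generating_character_separates:
  fixes \<omega> :: "'a::{finite,ring,monoid_mult} \<Rightarrow> complex"
  assumes "generating_character \<omega>" and "\<And>x. \<omega> (x * z) = 1"
  shows "z = 0"
proof (rule ccontr)
  assume "z \<noteq> 0"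
  have \<omega>: "additive_character \<omega>"
    using assms(1) by (simp add: generating_character_def)
  define n :: complex where "n = of_nat CARD('a)"
  have n: "n \<noteq> 0" by (simp add: n_def)
  define A :: "((complex, 'a) vec, 'a) vec" where "A = (\<chi> a x. \<omega> (a * x))"
  define B :: "((complex, 'a) vec, 'a) vec" where "B = (\<chi> x b. cnj (\<omega> (b * x)) / n)"
  have "(\<Sum>x\<in>UNIV. \<omega> (a * x) * (cnj (\<omega> (b * x)) / n)) = (if a = b then 1 else 0)" for a b
  proof -
    have "(\<Sum>x\<in>UNIV. \<omega> (a * x) * (cnj (\<omega> (b * x)) / n)) = (\<Sum>x\<in>UNIV. \<omega> ((a - b) * x)) / n"
      by (simp add: left_diff_distrib additive_character_diff[OF \<omega>] sum_divide_distrib mult.commute)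
    then show ?thesis
      using n by (simp add: sum_generating_character[OF assms(1)] n_def)
  qed
  then have "A ** B = mat 1"
    by (simp add: A_def B_def matrix_matrix_mult_def mat_def vec_eq_iff)
  then have "B ** A = mat 1"
    by (simp add: matrix_left_right_inverse)
  then have "(B ** A) $ 0 $ z = 0"
    using \<open>z \<noteq> 0\<close> by (simp add: mat_def)
  then have "(\<Sum>x\<in>UNIV. cnj (\<omega> (x * 0)) / n * \<omega> (x * z)) = 0"
    by (simp add: A_def B_def matrix_matrix_mult_def)
  then show False
    using n by (simp add: assms(2) additive_character_zero[OF \<omega>])
qed

section \<open>Orthonormal bases and tensor products\<close>

lemma cinner_axis:
  "cinner (axis a 1 :: complex^'n) (axis b 1) = (if a = b then 1 else 0)"
proof -
  have "cinner (axis a 1 :: complex^'n) (axis b 1)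
      = (\<Sum>k\<in>UNIV. if k = a then (if a = b then 1 else 0) else 0)"
    unfolding cinner_def by (rule sum.cong) (auto simp: axis_def)
  then show ?thesis by simp
qed

lemma cinner_tensor:
  fixes x x' :: "complex^'m" and y y' :: "complex^'n"
  shows "cinner (tensor x y) (tensor x' y') = cinner x x' * cinner y y'"
proof -
  have "cinner x x' * cinner y y'
      = (\<Sum>p\<in>UNIV \<times> UNIV. (cnj (x $ fst p) * x' $ fst p) * (cnj (y $ snd p) * y' $ snd p))"
    by (simp add: cinner_def sum_product sum.cartesian_product case_prod_unfold)
  then show ?thesis
    by (simp add: cinner_def tensor_def UNIV_Times_UNIV mult_ac)
qed

text \<open>
  With as many vectors as coordinates, spanning comes for free: the matrix with rows \<open>v k\<close>
  times its conjugate transpose is the identity, hence so is the product in the other order, and this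
  expands every vector in the \<open>v k\<close>.
\<close>

lemma orthonormal_basis_iff:
  fixes v :: "'n::finite \<Rightarrow> complex^'n"
  shows "orthonormal_basis v \<longleftrightarrow> (\<forall>k l. cinner (v k) (v l) = (if k = l then 1 else 0))"
proof
  assume orth: "\<forall>k l. cinner (v k) (v l) = (if k = l then 1 else 0)"
  define A :: "complex^'n^'n" where "A = (\<chi> k t. cnj (v k $ t))"
  define B :: "complex^'n^'n" where "B = (\<chi> t l. v l $ t)"
  have "A ** B = mat 1"
    using orth by (simp add: A_def B_def matrix_matrix_mult_def mat_def vec_eq_iff cinner_def)
  then have BA: "B ** A = mat 1"
    by (simp add: matrix_left_right_inverse)
  have "w \<in> vec.span (range v)" for w
  proof -
    have "w = B *v (A *v w)"
      by (simp add: matrix_vector_mul_assoc BA)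
    also have "\<dots> = (\<Sum>l\<in>UNIV. (A *v w) $ l *s v l)"
      by (simp add: B_def matrix_vector_mult_def vec_eq_iff mult.commute)
    also have "\<dots> \<in> vec.span (range v)"
      by (intro vec.span_sum vec.span_scale vec.span_base) simp
    finally show ?thesis .
  qed
  with orth show "orthonormal_basis v"
    by (auto simp: orthonormal_basis_def)
qed (simp add: orthonormal_basis_def)

lemma orthogonal_qls_iff:
  "orthogonal_qls \<psi> \<phi> \<longleftrightarrow>
     (\<forall>i j i' j'. cinner (\<psi> i j) (\<psi> i' j') * cinner (\<phi> i j) (\<phi> i' j')
        = (if i = i' \<and> j = j' then 1 else 0))"
  by (auto simp: orthogonal_qls_def orthonormal_basis_iff cinner_tensor)

lemma orthogonal_qls_commute: "orthogonal_qls \<psi> \<phi> \<longleftrightarrow> orthogonal_qls \<phi> \<psi>"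
  by (simp add: orthogonal_qls_iff mult.commute)

section \<open>Classical squares\<close>

lemma isotopic_refl: "isotopic \<psi> \<psi>"
proof -
  have "unitary (mat 1 :: complex^'n^'n)"
    by (auto simp: unitary_def Let_def map_matrix_def transpose_def mat_def matrix_matrix_mult_def
        vec_eq_iff if_distrib if_distribR cong: if_cong)
  then show ?thesis
    unfolding isotopic_def
    by (intro exI[of _ "\<lambda>_ _. 1"] exI[of _ id] exI[of _ "mat 1"]) simp
qed

text \<open>
  In a square whose entries are basis vectors, each row contains all of them, in particular the
  one standing in any prescribed cell; isotopy weakens equality to proportionality.
\<close>

lemma classical_qls_parallel_in_row:
  assumes "classical_qls \<psi>"
  shows "\<exists>j \<alpha>. \<psi> i j = \<alpha> *s \<psi> i' j'"
proof -
  obtain \<phi> c \<sigma> \<tau> U k where \<phi>: "quantum_latin_square \<phi>"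
    and c: "\<And>i j. norm (c i j :: complex) = 1" and \<sigma>: "bij \<sigma>" and \<tau>: "bij \<tau>" and U: "unitary U"
    and eq: "\<And>i j. \<phi> i j = c i j *s (U *v \<psi> (\<sigma> i) (\<tau> j))" and k: "\<And>i j. \<phi> i j = axis (k i j) 1"
    using assms unfolding classical_qls_def isotopic_def by metis
  obtain V where V: "V ** U = mat 1"
    using U by (auto simp: unitary_def Let_def)
  have \<psi>: "\<psi> (\<sigma> p) (\<tau> q) = inverse (c p q) *s (V *v axis (k p q) 1)" for p q
  proof -
    have "c p q \<noteq> 0" using c[of p q] by auto
    moreover have "V *v \<phi> p q = c p q *s \<psi> (\<sigma> p) (\<tau> q)"
      by (simp add: eq vector_scalar_commute matrix_vector_mul_assoc V)
    ultimately show ?thesis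
      by (simp add: k)
  qed
  obtain p p' q' where pq: "\<sigma> p = i" "\<sigma> p' = i'" "\<tau> q' = j'"
    using \<sigma> \<tau> by (metis bij_pointE)
  have "inj (k p)"
  proof (rule injI)
    fix q r assume "k p q = k p r"
    then have "cinner (\<phi> p q) (\<phi> p r) = 1"
      by (simp add: k cinner_axis)
    then show "q = r"
      using \<phi> by (auto simp: quantum_latin_square_def orthonormal_basis_def split: if_splits)
  qed
  then have "surj (k p)"
    by (simp add: finite_UNIV_inj_surj)
  then obtain q where q: "k p q = k p' q'"
    by (metis surjD)
  have "c p' q' \<noteq> 0" using c[of p' q'] by auto
  then have "\<psi> i (\<tau> q) = (inverse (c p q) * c p' q') *s \<psi> i' j'"
    using \<psi>[of p q] \<psi>[of p' q'] by (simp add: pq q)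
  then show ?thesis by blast
qed

section \<open>The squares of a Frobenius ring\<close>

text \<open>
  Rows, columns and coordinates are labelled by ring elements through a bijection \<open>e\<close>.
\<close>

definition linear_square ::
    "('n::finite \<Rightarrow> 'a::{finite,ring,monoid_mult}) \<Rightarrow> 'a \<Rightarrow> 'n vector_square" where
  "linear_square e a i j = axis (inv e (e i * a + e j)) 1"

definition character_square ::
    "('a \<Rightarrow> complex) \<Rightarrow> ('a \<Rightarrow> 'a) \<Rightarrow> ('n::finite \<Rightarrow> 'a::{finite,ring,monoid_mult})
      \<Rightarrow> 'n vector_square" where
  "character_square \<omega> g e i j =
     (\<chi> k. \<omega> (e j * e k - e i * g (e k)) / of_real (sqrt (real CARD('n))))"

lemma cinner_linear_square:
  assumes "bij e"
  shows "cinner (linear_square e a i j) (linear_square e a i' j')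
    = (if e i * a + e j = e i' * a + e j' then 1 else 0)"
proof -
  have "inj (inv e)"
    using assms by (simp add: bij_imp_bij_inv bij_is_inj)
  then show ?thesis
    by (simp add: linear_square_def cinner_axis inj_eq)
qed

text \<open>
  Two cells of a common line \<open>x a + c = l\<close> give the exponents \<open>l t - x (g t + a t)\<close> with the same
  \<open>l\<close>, so that the permutation \<open>t \<mapsto> g t + a t\<close> turns the inner product into a full character sum.
\<close>

lemma cinner_character_square:
  fixes e :: "'n::finite \<Rightarrow> 'a::{finite,ring,monoid_mult}"
  assumes "generating_character \<omega>" and e: "bij e" and p: "bij (\<lambda>t. g t + a * t)"
    and line: "e i * a + e j = e i' * a + e j'"
  shows "cinner (character_square \<omega> g e i j) (character_square \<omega> g e i' j')
    = (if i = i' then 1 else 0)"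
proof -
  have \<omega>: "additive_character \<omega>"
    using assms(1) by (simp add: generating_character_def)
  have card: "CARD('n) = CARD('a)"
    using e by (rule bij_betw_same_card)
  have sq: "complex_of_real (sqrt (real CARD('n))) * of_real (sqrt (real CARD('n)))
      = of_nat CARD('a)"
    by (metis card of_real_mult of_real_of_nat_eq of_nat_0_le_iff real_sqrt_mult_self abs_of_nonneg)
  have ej: "e j' = (e i - e i') * a + e j"
    using line by (simp add: algebra_simps)
  have exponent: "(e j' * t - e i' * g t) - (e j * t - e i * g t) = (e i - e i') * (g t + a * t)"
    for t
    by (simp add: ej algebra_simps)
  have "cinner (character_square \<omega> g e i j) (character_square \<omega> g e i' j')
      = (\<Sum>k\<in>UNIV. \<omega> ((e i - e i') * (g (e k) + a * e k)) / of_nat CARD('a))"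
    unfolding cinner_def
  proof (rule sum.cong)
    fix k
    show "cnj (character_square \<omega> g e i j $ k) * character_square \<omega> g e i' j' $ k
        = \<omega> ((e i - e i') * (g (e k) + a * e k)) / of_nat CARD('a)"
      by (simp only: character_square_def vec_lambda_beta complex_cnj_divide complex_cnj_complex_of_real
          times_divide_times_eq sq flip: exponent additive_character_diff[OF \<omega>])
  qed simp
  also have "\<dots> = (\<Sum>t\<in>UNIV. \<omega> ((e i - e i') * (g t + a * t)) / of_nat CARD('a))"
    using e by (rule sum.reindex_bij_betw)
  also have "\<dots> = (\<Sum>s\<in>UNIV. \<omega> ((e i - e i') * s) / of_nat CARD('a))"
    using p by (rule sum.reindex_bij_betw)
  also have "\<dots> = (if e i - e i' = 0 then 1 else 0)"
    by (simp add: sum_generating_character[OF assms(1)] flip: sum_divide_distrib)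
  finally show ?thesis
    using e by (simp add: bij_is_inj inj_eq)
qed

text \<open>
  Columns are the lines of slope parameter \<open>0\<close>.  In a row the terms \<open>x g t\<close> of the exponents
  cancel and leave \<open>\<omega> ((c' - c) t)\<close>, a column sum of the square of the identity map in which \<open>c\<close>
  and \<open>c'\<close> take the part of \<open>x\<close>.
\<close>

lemma quantum_latin_square_character_square:
  fixes e :: "'n::finite \<Rightarrow> 'a::{finite,ring,monoid_mult}"
  assumes "generating_character \<omega>" and e: "bij e" and g: "bij g"
  shows "quantum_latin_square (character_square \<omega> g e)"
proof -
  have \<omega>: "additive_character \<omega>"
    using assms(1) by (simp add: generating_character_def)
  have column: "cinner (character_square \<omega> g e i j) (character_square \<omega> g e i' j)
      = (if i = i' then 1 else 0)" for i i' j
    using assms by (intro cinner_character_square[where a = 0]) auto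
  have row: "cinner (character_square \<omega> g e i j) (character_square \<omega> g e i j')
      = (if j = j' then 1 else 0)" for i j j'
  proof -
    have exponent: "(e j' * t - e i * g t) - (e j * t - e i * g t)
        = (e i * t - e j * t) - (e i * t - e j' * t)" for t
      by simp
    have "cnj (\<omega> (e j * t - e i * g t)) * \<omega> (e j' * t - e i * g t)
        = cnj (\<omega> (e i * t - e j' * t)) * \<omega> (e i * t - e j * t)" for t
      by (simp only: exponent flip: additive_character_diff[OF \<omega>])
    then have "cinner (character_square \<omega> g e i j) (character_square \<omega> g e i j')
        = cinner (character_square \<omega> (\<lambda>t. t) e j' i) (character_square \<omega> (\<lambda>t. t) e j i)"
      by (simp add: cinner_def character_square_def)
    also have "\<dots> = (if j' = j then 1 else 0)"
      using assms by (intro cinner_character_square[where a = 0]) (auto simp: bij_def)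
    finally show ?thesis by auto
  qed
  show ?thesis
    by (simp add: quantum_latin_square_def orthonormal_basis_iff row column)
qed

lemma ring_units_right_cancel:
  assumes "u \<in> ring_units" and "x * u = y * u"
  shows "x = y"
proof -
  obtain v where "u * v = 1"
    using assms(1) by (auto simp: ring_units_def)
  then show ?thesis
    using assms(2) by (metis mult.assoc mult_1_right)
qed

lemma quantum_latin_square_linear_square:
  assumes "bij e" and "a \<in> ring_units"
  shows "quantum_latin_square (linear_square e a)"
  using ring_units_right_cancel[OF assms(2)] bij_is_inj[OF assms(1)]
  by (auto simp: quantum_latin_square_def orthonormal_basis_iff cinner_linear_square[OF assms(1)]
      dest: injD)

lemma classical_qls_linear_square:
  assumes "bij e" and "a \<in> ring_units"
  shows "classical_qls (linear_square e a)"
  using quantum_latin_square_linear_square[OF assms] isotopic_refl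
  unfolding classical_qls_def by (metis linear_square_def)

lemma orthogonal_linear_squares:
  fixes e :: "'n::finite \<Rightarrow> 'a::{finite,ring,monoid_mult}"
  assumes e: "bij e" and u: "a - b \<in> ring_units"
  shows "orthogonal_qls (linear_square e a) (linear_square e b)"
proof -
  have "i = i' \<and> j = j'"
    if "e i * a + e j = e i' * a + e j'" "e i * b + e j = e i' * b + e j'" for i j i' j'
  proof -
    have "e i * (a - b) = (e i * a + e j) - (e i * b + e j)"
      by (simp add: right_diff_distrib)
    also have "\<dots> = e i' * (a - b)"
      by (simp add: right_diff_distrib that)
    finally have "e i = e i'"
      using ring_units_right_cancel[OF u] by blast
    then show ?thesis
      using that bij_is_inj[OF e] by (auto dest: injD)
  qed
  then show ?thesis
    by (auto simp: orthogonal_qls_iff cinner_linear_square[OF e])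
qed

text \<open>
  A tensor product of entries with different classical symbols is orthogonal for free; equal symbols
  mean a common line.
\<close>

lemma orthogonal_character_linear_square:
  fixes e :: "'n::finite \<Rightarrow> 'a::{finite,ring,monoid_mult}"
  assumes "generating_character \<omega>" and e: "bij e" and p: "bij (\<lambda>t. g t + a * t)"
  shows "orthogonal_qls (character_square \<omega> g e) (linear_square e a)"
proof -
  have "cinner (character_square \<omega> g e i j) (character_square \<omega> g e i' j')
      * cinner (linear_square e a i j) (linear_square e a i' j')
      = (if i = i' \<and> j = j' then 1 else 0)" for i j i' j'
  proof (cases "e i * a + e j = e i' * a + e j'")
    case True
    then have "i = i' \<longleftrightarrow> i = i' \<and> j = j'"
      using bij_is_inj[OF e] by (auto dest: injD)
    then show ?thesis
      using cinner_character_square[where \<omega> = \<omega> and g = g, OF assms True] True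
      by (simp add: cinner_linear_square[OF e])
  next
    case False
    then show ?thesis
      by (auto simp: cinner_linear_square[OF e])
  qed
  then show ?thesis
    by (simp add: orthogonal_qls_iff)
qed

text \<open>
  The entry of row \<open>x\<close> that is parallel to the constant vector at \<open>(0, 0)\<close> has
  \<open>\<omega> (c t - x g t)\<close> independent of \<open>t\<close>, that is, \<open>\<omega> (x (g t - g 0)) = \<omega> (c t)\<close>.  As the right
  side is multiplicative in \<open>t\<close>, the deviation of \<open>g - g 0\<close> from additivity is killed by every
  \<open>\<omega> (x \<cdot>)\<close>.
\<close>

lemma classical_character_square_imp_affine:
  fixes e :: "'n::finite \<Rightarrow> 'a::{finite,ring,monoid_mult}"
  assumes \<omega>g: "generating_character \<omega>" and e: "bij e"
    and classical: "classical_qls (character_square \<omega> g e)"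
  shows "Modules.additive (\<lambda>t. g t - g 0)"
proof
  have \<omega>: "additive_character \<omega>"
    using \<omega>g by (simp add: generating_character_def)
  have add: "\<omega> (x + y) = \<omega> x * \<omega> y" for x y
    using \<omega> by (simp add: additive_character_def)
  have nz: "\<omega> x \<noteq> 0" for x
    using \<omega> by (metis additive_character_def norm_zero zero_neq_one)
  obtain z where z: "e z = 0"
    using e by (metis bij_pointE)
  have row: "\<exists>c. \<forall>t. \<omega> (x * (g t - g 0)) = \<omega> (c * t)" for x
  proof -
    obtain i where i: "e i = x"
      using e by (metis bij_pointE)
    obtain j \<alpha> where "character_square \<omega> g e i j = \<alpha> *s character_square \<omega> g e z z"
      using classical_qls_parallel_in_row[OF classical] by metis
    then have "\<omega> (e j * e k - e i * g (e k)) = \<alpha>" for k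
      by (auto simp: character_square_def vec_eq_iff z additive_character_zero[OF \<omega>])
    then have const: "\<omega> (e j * t - x * g t) = \<alpha>" for t
      using e i by (metis bij_pointE)
    have "\<omega> (x * (g t - g 0)) = \<omega> (e j * t)" for t
    proof -
      have "\<omega> (e j * t - x * g t) * \<omega> (x * (g t - g 0)) = \<omega> (e j * 0 - x * g 0) * \<omega> (e j * t)"
        by (simp add: algebra_simps flip: add)
      then show ?thesis
        using nz[of "- (x * g 0)"] const[of t] const[of 0] by simp
    qed
    then show ?thesis by blast
  qed
  fix s t
  define d where "d = (g (s + t) - g 0) - ((g s - g 0) + (g t - g 0))"
  have "\<omega> (x * d) = 1" for x
  proof -
    obtain c where c: "\<And>t. \<omega> (x * (g t - g 0)) = \<omega> (c * t)"
      using row by blast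
    have "\<omega> (x * (g (s + t) - g 0)) = \<omega> (x * ((g s - g 0) + (g t - g 0)))"
      by (simp only: distrib_left add c)
    moreover have "\<omega> (x * (g (s + t) - g 0)) = \<omega> (x * d) * \<omega> (x * ((g s - g 0) + (g t - g 0)))"
      by (simp add: d_def flip: add distrib_left)
    ultimately show ?thesis
      using nz by simp
  qed
  then have "d = 0"
    by (rule generating_character_separates[OF \<omega>g])
  then show "g (s + t) - g 0 = (g s - g 0) + (g t - g 0)"
    by (simp add: d_def)
qed

theorem theorem6:
  fixes f :: "'a::{finite,ring,monoid_mult} \<Rightarrow> 'a"
    and M :: "'a set"
  assumes "frobenius_ring TYPE('a)"
    and "CARD('n::finite) = CARD('a)"
    and "\<not> (\<exists>g c. Modules.additive g \<and> f = (\<lambda>x. g x + c))"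
    and "M \<noteq> {}"
    and "\<And>m. m \<in> M \<Longrightarrow> bij (\<lambda>x. f x - m * x)"
    and "\<And>m m'. m \<in> M \<Longrightarrow> m' \<in> M \<Longrightarrow> m \<noteq> m' \<Longrightarrow> m - m' \<in> ring_units"
  shows "\<exists>Q :: 'n vector_square set.
           mutually_orthogonal_qls Q \<and> card Q = card M \<and>
           (\<exists>!\<psi>. \<psi> \<in> Q \<and> \<not> classical_qls \<psi>)"
proof -
  obtain \<omega> :: "'a \<Rightarrow> complex" where \<omega>: "generating_character \<omega>"
    using assms(1) by (auto simp: frobenius_ring_def)
  obtain e :: "'n \<Rightarrow> 'a" where e: "bij e"
    using assms(2) finite_same_card_bij[of "UNIV :: 'n set" "UNIV :: 'a set"] by auto
  obtain m0 where m0: "m0 \<in> M"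
    using assms(4) by blast
  define g where "g = (\<lambda>t. f t - m0 * t)"
  have g: "bij g"
    unfolding g_def by (rule assms(5)[OF m0])
  define \<psi> where "\<psi> = character_square \<omega> g e"
  define L where "L = (\<lambda>m. linear_square e (m0 - m))"
  define N where "N = M - {m0}"
  have perm: "bij (\<lambda>t. g t + (m0 - m) * t)" if "m \<in> N" for m
    using assms(5)[of m] that by (simp add: g_def N_def left_diff_distrib)
  have unit: "m0 - m \<in> ring_units" if "m \<in> N" for m
    using assms(6)[of m0 m] m0 that by (auto simp: N_def)
  have nonclassical: "\<not> classical_qls \<psi>"
  proof
    assume "classical_qls \<psi>"
    then have "Modules.additive (\<lambda>t. g t - g 0)"
      unfolding \<psi>_def by (rule classical_character_square_imp_affine[OF \<omega> e])
    then have "Modules.additive (\<lambda>t. g t - g 0 + m0 * t)"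
      by (simp add: Modules.additive_def distrib_left)
    moreover have "f = (\<lambda>t. (g t - g 0 + m0 * t) + g 0)"
      by (simp add: g_def)
    ultimately show False
      using assms(3) by blast
  qed
  have classical: "classical_qls (L m)" if "m \<in> N" for m
    unfolding L_def using e unit[OF that] by (rule classical_qls_linear_square)
  (* The symbol in the cell (1, 0) is the slope parameter itself. *)
  have inj: "inj_on L N"
  proof (rule inj_onI)
    fix m m' assume eq: "L m = L m'"
    obtain i j where ij: "e i = 1" "e j = 0"
      using e by (metis bij_pointE)
    have "cinner (L m i j) (L m' i j) = 1"
      by (simp add: eq) (simp add: L_def cinner_linear_square[OF e])
    moreover have "inj (inv e)"
      using e by (simp add: bij_imp_bij_inv bij_is_inj)
    ultimately show "m = m'"
      by (auto simp: L_def linear_square_def ij cinner_axis inj_eq split: if_splits)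
  qed
  have orthL: "orthogonal_qls (L m) (L m')" if "m \<in> N" "m' \<in> N" "m \<noteq> m'" for m m'
    unfolding L_def using that assms(6)[of m' m] by (intro orthogonal_linear_squares[OF e]) (simp add: N_def)
  have orth\<psi>: "orthogonal_qls \<psi> (L m)" if "m \<in> N" for m
    unfolding \<psi>_def L_def using \<omega> e perm[OF that] by (rule orthogonal_character_linear_square)
  then have orth\<psi>': "orthogonal_qls (L m) \<psi>" if "m \<in> N" for m
    using that by (simp add: orthogonal_qls_commute)
  have "mutually_orthogonal_qls (insert \<psi> (L ` N))"
    unfolding mutually_orthogonal_qls_def
  proof
    show "\<forall>\<phi>\<in>insert \<psi> (L ` N). quantum_latin_square \<phi>"
      using quantum_latin_square_character_square[OF \<omega> e g]
        quantum_latin_square_linear_square[OF e unit]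
      by (auto simp: \<psi>_def L_def)
    have "pairwise orthogonal_qls (L ` N)"
      unfolding pairwise_image by (rule pairwiseI) (metis orthL)
    then show "pairwise orthogonal_qls (insert \<psi> (L ` N))"
      unfolding pairwise_insert using orth\<psi> orth\<psi>' by blast
  qed
  moreover have "card (insert \<psi> (L ` N)) = card M"
  proof -
    have "\<psi> \<notin> L ` N"
      using nonclassical classical by auto
    then have "card (insert \<psi> (L ` N)) = Suc (card N)"
      by (simp add: card_image[OF inj])
    then show ?thesis
      using m0 card_Suc_Diff1[of M m0] by (simp add: N_def)
  qed
  moreover have "\<exists>!\<phi>. \<phi> \<in> insert \<psi> (L ` N) \<and> \<not> classical_qls \<phi>"
  proof (rule ex1I)
    show "\<psi> \<in> insert \<psi> (L ` N) \<and> \<not> classical_qls \<psi>"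
      using nonclassical by simp
    show "\<phi> = \<psi>" if "\<phi> \<in> insert \<psi> (L ` N) \<and> \<not> classical_qls \<phi>" for \<phi>
      using that classical by auto
  qed
  ultimately show ?thesis
    by (intro exI conjI)
qed

end
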